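(* Let $\nu_1,\dots,\nu_k\in\mathbb{R}^d$ be (current) centers, labelled so that $\nu_r$ is the center closest to $\mu_r$, and let $\delta_r=|\mu_r-\nu_r|$. For each $s$ let $S_s$ be the set of points $A_i$ whose closest center among $\nu_1,\dots,\nu_k$ is $\nu_s$. Assume $\delta_r+\delta_s\le \Delta_{rs}/16$ for all $r\neq s$. Then for all $r\neq s$: (1) $|T_r\cap S_s\cap G| \le \frac{6ck\,\|A-C\|^2(\delta_r^2+\delta_s^2)}{\Delta_{rs}^2\,|\mu_r-\mu_s|^2}$; (2) for every nonempty $W\subseteq T_r\cap S_s$, the mean $m(W)$ of the points in $W$ satisfies $|m(W)-\mu_s|\le \frac{100\,\|A-C\|}{\sqrt{|W|}}$.
   Context: We are given $n$ points $A_1,\dots,A_n\in\mathbb{R}^d$, forming the rows of an $n\times d$ matrix $A$, partitioned into nonempty clusters $T_1,\dots,T_k$. Write $n_r=|T_r|$, $\mu_r$ for the mean of $T_r$, and $C$ for the $n\times d$ matrix with $C_i=\mu_r$ for $i\in T_r$. $\|\cdot\|$ is the spectral norm, $|\cdot|$ the Euclidean norm. $c$ is a sufficiently large absolute constant and $\Delta_{rs}=\left(\frac{ck}{\sqrt{n_r}}+\frac{ck}{\sqrt{n_s}}\right)\|A-C\|$. A point $A_i\in T_r$ satisfies the proximity condition if for every $s\neq r$ the orthogonal projection $p$ of $A_i$ onto the line through $\mu_r,\mu_s$ satisfies $|p-\mu_s|-|p-\mu_r|\ge\Delta_{rs}$; $G$ is the set of such points.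
   Formalization: The means μ_r are assumed pairwise distinct, and (2) is proved only for pairs with Δ_rs ≤ |μ_r−μ_s| (automatic if some point of T_r or T_s satisfies the proximity condition); without this (2) is false for large c. *)

theory Defs
  imports Complex_Main "HOL-Library.Disjoint_Sets" "Jordan_Normal_Form.Matrix"
begin

text \<open>
  The constant \<open>c\<close> must not depend on the dimensions, so \<open>n\<close>, \<open>d\<close>, \<open>k\<close> have to be quantified inside
  the formula; hence explicit carriers instead of dimensions as types. Points are the rows of an
  \<open>n \<times> d\<close> matrix, and sets of points are sets of row indices (several points may coincide).
\<close>

definition vnorm :: "real vec \<Rightarrow> real" where
  "vnorm v = sqrt (v \<bullet> v)"

definition spectral_norm :: "real mat \<Rightarrow> real" where
  "spectral_norm M = (SUP x \<in> {x \<in> carrier_vec (dim_col M). vnorm x \<le> 1}. vnorm (M *\<^sub>v x))"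

definition centroid :: "real mat \<Rightarrow> nat set \<Rightarrow> real vec" where
  "centroid A W = vec (dim_col A) (\<lambda>j. (\<Sum>i\<in>W. A $$ (i, j)) / real (card W))"

definition clustering :: "nat \<Rightarrow> nat \<Rightarrow> (nat \<Rightarrow> nat set) \<Rightarrow> bool" where
  "clustering n k T \<longleftrightarrow>
     (\<Union>r<k. T r) = {..<n} \<and> disjoint_family_on T {..<k} \<and> (\<forall>r<k. T r \<noteq> {})"

definition center_matrix :: "nat \<Rightarrow> real mat \<Rightarrow> (nat \<Rightarrow> nat set) \<Rightarrow> real mat \<Rightarrow> bool" where
  "center_matrix k A T C \<longleftrightarrow>
     C \<in> carrier_mat (dim_row A) (dim_col A) \<and> (\<forall>r<k. \<forall>i\<in>T r. row C i = centroid A (T r))"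

definition Delta ::
  "real \<Rightarrow> nat \<Rightarrow> real mat \<Rightarrow> real mat \<Rightarrow> (nat \<Rightarrow> nat set) \<Rightarrow> nat \<Rightarrow> nat \<Rightarrow> real" where
  "Delta c k A C T r s =
     (c * real k / sqrt (real (card (T r))) + c * real k / sqrt (real (card (T s))))
       * spectral_norm (A - C)"

text \<open>
  Orthogonal projection of \<open>x\<close> onto the line through \<open>a\<close> and \<open>b\<close>; meaningful only for \<open>a \<noteq> b\<close>.
\<close>

definition line_proj :: "real vec \<Rightarrow> real vec \<Rightarrow> real vec \<Rightarrow> real vec" where
  "line_proj a b x = a + (((x - a) \<bullet> (b - a)) / ((b - a) \<bullet> (b - a))) \<cdot>\<^sub>v (b - a)"

lemma line_proj_unique:
  assumes a: "a \<in> carrier_vec d" and b: "b \<in> carrier_vec d" and x: "x \<in> carrier_vec d"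
    and "a \<noteq> b"
  shows "p = line_proj a b x \<longleftrightarrow> (\<exists>t. p = a + t \<cdot>\<^sub>v (b - a)) \<and> (x - p) \<bullet> (b - a) = 0"
proof -
  define w where "w = b - a"
  have w: "w \<in> carrier_vec d" using a b by (simp add: w_def)
  have "w \<bullet> w \<noteq> 0"
  proof
    assume "w \<bullet> w = 0"
    then have 0: "(\<Sum>j\<in>{0..<d}. w $ j * w $ j) = 0"
      using w by (simp add: scalar_prod_def)
    have "\<forall>j\<in>{0..<d}. w $ j * w $ j = 0"
      using 0 by (subst (asm) sum_nonneg_eq_0_iff) auto
    then have "a = b"
      using a b by (intro eq_vecI) (auto simp: w_def)
    with \<open>a \<noteq> b\<close> show False by simp
  qed
  moreover have key: "(x - (a + t \<cdot>\<^sub>v w)) \<bullet> w = (x - a) \<bullet> w - t * (w \<bullet> w)" for t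
  proof -
    have "x - (a + t \<cdot>\<^sub>v w) = (x - a) - t \<cdot>\<^sub>v w"
      using a x w by (intro eq_vecI) auto
    then show ?thesis
      using a x w by (simp add: minus_scalar_prod_distrib[of _ d])
  qed
  ultimately have iff: "(x - (a + t \<cdot>\<^sub>v w)) \<bullet> w = 0 \<longleftrightarrow> t = ((x - a) \<bullet> w) / (w \<bullet> w)" for t
    by (metis eq_iff_diff_eq_0 nonzero_eq_divide_eq)
  show ?thesis
    unfolding line_proj_def w_def[symmetric]
  proof
    assume "p = a + (((x - a) \<bullet> w) / (w \<bullet> w)) \<cdot>\<^sub>v w"
    then show "(\<exists>t. p = a + t \<cdot>\<^sub>v w) \<and> (x - p) \<bullet> w = 0"
      using iff[of "((x - a) \<bullet> w) / (w \<bullet> w)"] by metis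
  next
    assume "(\<exists>t. p = a + t \<cdot>\<^sub>v w) \<and> (x - p) \<bullet> w = 0"
    then obtain t where t: "p = a + t \<cdot>\<^sub>v w" and "(x - p) \<bullet> w = 0" by (elim conjE exE)
    with iff[of t] have "t = ((x - a) \<bullet> w) / (w \<bullet> w)" by metis
    with t show "p = a + (((x - a) \<bullet> w) / (w \<bullet> w)) \<cdot>\<^sub>v w" by metis
  qed
qed

definition proximity_set ::
  "real \<Rightarrow> nat \<Rightarrow> real mat \<Rightarrow> real mat \<Rightarrow> (nat \<Rightarrow> nat set) \<Rightarrow> nat set" where
  "proximity_set c k A C T =
     {i. \<exists>r<k. i \<in> T r \<and>
        (\<forall>s<k. s \<noteq> r \<longrightarrow>
          (let p = line_proj (centroid A (T r)) (centroid A (T s)) (row A i)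
           in vnorm (p - centroid A (T s)) - vnorm (p - centroid A (T r)) \<ge> Delta c k A C T r s))}"

text \<open>
  A point with several closest centers belongs to the set of each of them, so that a result about
  these sets covers every way of breaking ties.
\<close>

definition nearest_set :: "nat \<Rightarrow> real mat \<Rightarrow> (nat \<Rightarrow> real vec) \<Rightarrow> nat \<Rightarrow> nat set" where
  "nearest_set k A \<nu> s =
     {i. i < dim_row A \<and> (\<forall>t<k. vnorm (row A i - \<nu> s) \<le> vnorm (row A i - \<nu> t))}"

end

theory Submission
  imports Defs "HOL-Analysis.L2_Norm"
begin

text \<open>
  Write \<open>y\<close> for a row of \<open>A - C\<close> in \<open>T\<^sub>r\<close>, \<open>u = \<mu>\<^sub>s - \<mu>\<^sub>r\<close>, \<open>e\<^sub>r = \<nu>\<^sub>r - \<mu>\<^sub>r\<close> and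
  \<open>e\<^sub>s = \<nu>\<^sub>s - \<mu>\<^sub>s\<close>. If the point is proximal, then \<open>2 y \<bullet> u \<le> \<bar>u\<bar>\<^sup>2 - \<Delta> \<bar>u\<bar>\<close>; if it is
  nevertheless assigned to \<open>\<nu>\<^sub>s\<close>, expanding \<open>\<bar>y - (u + e\<^sub>s)\<bar> \<le> \<bar>y - e\<^sub>r\<bar>\<close> shows that
  \<open>y \<bullet> (e\<^sub>s - e\<^sub>r)\<close> is at least a constant times \<open>\<Delta> \<bar>u\<bar>\<close>. The sum of the squares of these
  products is at most \<open>\<parallel>A - C\<parallel>\<^sup>2 \<bar>e\<^sub>s - e\<^sub>r\<bar>\<^sup>2\<close>, which bounds the number of such points.

  For (2), being closer to \<open>\<nu>\<^sub>s\<close> than to \<open>\<nu>\<^sub>r\<close> is an affine condition, hence passes to the mean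
  \<open>m\<close> of \<open>W\<close>. So \<open>\<bar>m - \<mu>\<^sub>r\<bar>\<close>, which is at most \<open>\<parallel>A - C\<parallel> / \<surd>\<bar>W\<bar>\<close>, is at least a constant
  times \<open>\<bar>\<mu>\<^sub>r - \<mu>\<^sub>s\<bar>\<close>, and the triangle inequality gives the claim.
\<close>

section \<open>The Euclidean norm and the spectral norm\<close>

text \<open>Transfers the Cauchy-Schwarz and triangle inequalities of \<open>L2_set\<close> to
  vectors.\<close>

lemma vnorm_L2_set: "vnorm v = L2_set (($) v) {0..<dim_vec v}"
  by (simp add: vnorm_def L2_set_def scalar_prod_def power2_eq_square)

lemma vnorm_nonneg [simp]: "0 \<le> vnorm v"
  by (simp add: vnorm_L2_set)

lemma vnorm_sq: "(vnorm v)\<^sup>2 = v \<bullet> v"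
proof -
  have "0 \<le> v \<bullet> v"
    by (auto simp: scalar_prod_def intro: sum_nonneg)
  then show ?thesis
    by (simp add: vnorm_def)
qed

lemma vnorm_eq_0_iff:
  assumes "v \<in> carrier_vec d"
  shows "vnorm v = 0 \<longleftrightarrow> v = 0\<^sub>v d"
  using assms by (auto simp: vnorm_L2_set L2_set_eq_0_iff)

lemma vnorm_minus_eq_0_iff:
  assumes "v \<in> carrier_vec d" "w \<in> carrier_vec d"
  shows "vnorm (v - w) = 0 \<longleftrightarrow> v = w"
  using assms by (auto simp: vnorm_L2_set L2_set_eq_0_iff)

lemma abs_scalar_prod_le:
  assumes "v \<in> carrier_vec d" "w \<in> carrier_vec d"
  shows "\<bar>v \<bullet> w\<bar> \<le> vnorm v * vnorm w"
proof -
  have "\<bar>v \<bullet> w\<bar> \<le> (\<Sum>j=0..<d. \<bar>v $ j\<bar> * \<bar>w $ j\<bar>)"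
    using assms by (auto simp: scalar_prod_def abs_mult[symmetric] intro: sum_abs)
  also have "\<dots> \<le> vnorm v * vnorm w"
    using L2_set_mult_ineq[of "($) v" "($) w" "{0..<d}"] assms by (simp add: vnorm_L2_set)
  finally show ?thesis .
qed

lemma vnorm_add_le:
  assumes "v \<in> carrier_vec d" "w \<in> carrier_vec d"
  shows "vnorm (v + w) \<le> vnorm v + vnorm w"
proof -
  have "vnorm (v + w) = L2_set (\<lambda>j. v $ j + w $ j) {0..<d}"
    using assms by (auto simp: vnorm_L2_set intro!: L2_set_cong)
  then show ?thesis
    using L2_set_triangle_ineq[of "($) v" "($) w" "{0..<d}"] assms by (simp add: vnorm_L2_set)
qed

lemma vnorm_smult: "vnorm (a \<cdot>\<^sub>v v) = \<bar>a\<bar> * vnorm v"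
proof -
  have "vnorm (a \<cdot>\<^sub>v v) = sqrt (a\<^sup>2 * (v \<bullet> v))"
    by (simp add: vnorm_def scalar_prod_def power2_eq_square sum_distrib_left ac_simps)
  then show ?thesis
    by (simp add: real_sqrt_mult vnorm_def)
qed

lemma vnorm_minus_commute:
  assumes "v \<in> carrier_vec d" "w \<in> carrier_vec d"
  shows "vnorm (v - w) = vnorm (w - v)"
proof -
  have "v - w = (- 1) \<cdot>\<^sub>v (w - v)"
    using assms by (intro eq_vecI) auto
  then show ?thesis
    by (simp add: vnorm_smult)
qed

lemma vnorm_triangle:
  assumes "a \<in> carrier_vec d" "b \<in> carrier_vec d" "x \<in> carrier_vec d"
  shows "vnorm (a - b) \<le> vnorm (a - x) + vnorm (x - b)"
proof -
  have "a - b = (a - x) + (x - b)"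
    using assms by (intro eq_vecI) auto
  then show ?thesis
    using vnorm_add_le[of "a - x" d "x - b"] assms by simp
qed

lemma vnorm_minus_sq:
  assumes v: "v \<in> carrier_vec d" and w: "w \<in> carrier_vec d"
  shows "(vnorm (v - w))\<^sup>2 = (vnorm v)\<^sup>2 - 2 * (v \<bullet> w) + (vnorm w)\<^sup>2"
  using v w comm_scalar_prod[OF v w]
  by (simp add: vnorm_sq minus_scalar_prod_distrib[of _ d] scalar_prod_minus_distrib[of _ d])

lemma vnorm_add_sq:
  assumes v: "v \<in> carrier_vec d" and w: "w \<in> carrier_vec d"
  shows "(vnorm (v + w))\<^sup>2 = (vnorm v)\<^sup>2 + 2 * (v \<bullet> w) + (vnorm w)\<^sup>2"
  using v w comm_scalar_prod[OF v w]
  by (simp add: vnorm_sq add_scalar_prod_distrib[of _ d] scalar_prod_add_distrib[of _ d])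

text \<open>After squaring, the terms \<open>(vnorm v)\<^sup>2\<close> cancel, so being nearer to
  one center than to another is a half-space condition, affine in \<open>v\<close>.\<close>

lemma nearer_iff:
  assumes v: "v \<in> carrier_vec d" and a: "a \<in> carrier_vec d" and b: "b \<in> carrier_vec d"
  shows "vnorm (v - a) \<le> vnorm (v - b) \<longleftrightarrow> 2 * (v \<bullet> (b - a)) \<le> (vnorm b)\<^sup>2 - (vnorm a)\<^sup>2"
proof -
  have "vnorm (v - a) \<le> vnorm (v - b) \<longleftrightarrow> (vnorm (v - a))\<^sup>2 \<le> (vnorm (v - b))\<^sup>2"
    by (simp add: abs_le_square_iff[symmetric])
  then show ?thesis
    using assms by (simp add: vnorm_minus_sq scalar_prod_minus_distrib[of _ d] algebra_simps)
qed

section \<open>Operator inequality for the spectral norm\<close>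

lemma vnorm_mult_mat_vec_sq:
  "(vnorm (M *\<^sub>v x))\<^sup>2 = (\<Sum>i<dim_row M. (row M i \<bullet> x)\<^sup>2)"
  unfolding vnorm_sq scalar_prod_def[of "M *\<^sub>v x"]
  by (simp add: power2_eq_square lessThan_atLeast0)

text \<open>A real \<open>SUP\<close> is informative only over a bounded set; by Cauchy-Schwarz in
  each row, the Frobenius norm is a bound.\<close>

lemma bdd_above_spectral_norm:
  "bdd_above ((\<lambda>x. vnorm (M *\<^sub>v x)) ` {x \<in> carrier_vec (dim_col M). vnorm x \<le> 1})"
proof (rule bdd_aboveI2)
  fix x assume x: "x \<in> {x \<in> carrier_vec (dim_col M). vnorm x \<le> 1}"
  have "(row M i \<bullet> x)\<^sup>2 \<le> (vnorm (row M i))\<^sup>2" for i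
  proof -
    have "\<bar>row M i \<bullet> x\<bar> \<le> vnorm (row M i) * vnorm x"
      using x by (intro abs_scalar_prod_le[of _ "dim_col M"]) (auto simp: row_def)
    also have "\<dots> \<le> vnorm (row M i)"
      using x by (simp add: mult_left_le)
    finally show ?thesis
      by (simp add: abs_le_square_iff[symmetric])
  qed
  then have "(vnorm (M *\<^sub>v x))\<^sup>2 \<le> (\<Sum>i<dim_row M. (vnorm (row M i))\<^sup>2)"
    unfolding vnorm_mult_mat_vec_sq by (intro sum_mono)
  then show "vnorm (M *\<^sub>v x) \<le> sqrt (\<Sum>i<dim_row M. (vnorm (row M i))\<^sup>2)"
    by (rule real_le_rsqrt)
qed

lemma spectral_norm_nonneg: "0 \<le> spectral_norm M"
proof -
  have "0\<^sub>v (dim_col M) \<in> {x \<in> carrier_vec (dim_col M). vnorm x \<le> 1}"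
    by (auto simp: vnorm_def)
  then have "vnorm (M *\<^sub>v 0\<^sub>v (dim_col M)) \<le> spectral_norm M"
    unfolding spectral_norm_def by (intro cSUP_upper bdd_above_spectral_norm)
  then show ?thesis
    using vnorm_nonneg order_trans by blast
qed

lemma vnorm_mult_mat_vec_le:
  assumes x: "x \<in> carrier_vec (dim_col M)"
  shows "vnorm (M *\<^sub>v x) \<le> spectral_norm M * vnorm x"
proof (cases "vnorm x = 0")
  case True
  then have "x = 0\<^sub>v (dim_col M)"
    using x vnorm_eq_0_iff by blast
  then have "vnorm (M *\<^sub>v x) = 0"
    by (simp add: vnorm_def scalar_prod_def)
  then show ?thesis
    using True by simp
next
  case False
  then have pos: "vnorm x > 0"
    using vnorm_nonneg[of x] by linarith
  let ?z = "(1 / vnorm x) \<cdot>\<^sub>v x"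
  have "?z \<in> {x \<in> carrier_vec (dim_col M). vnorm x \<le> 1}"
    using x pos by (simp add: vnorm_smult)
  then have "vnorm (M *\<^sub>v ?z) \<le> spectral_norm M"
    unfolding spectral_norm_def by (intro cSUP_upper bdd_above_spectral_norm)
  moreover have "M *\<^sub>v ?z = (1 / vnorm x) \<cdot>\<^sub>v (M *\<^sub>v x)"
    using x by (intro mult_mat_vec) auto
  ultimately show ?thesis
    using pos by (simp add: vnorm_smult field_simps)
qed

text \<open>Over all rows the sum is \<open>(vnorm (M *\<^sub>v w))\<^sup>2\<close>; restricting to
  \<open>F\<close> drops nonnegative terms.\<close>

lemma sum_row_scalar_prod_sq_le:
  assumes "F \<subseteq> {..<dim_row M}" and w: "w \<in> carrier_vec (dim_col M)"
  shows "(\<Sum>i\<in>F. (row M i \<bullet> w)\<^sup>2) \<le> (spectral_norm M)\<^sup>2 * (vnorm w)\<^sup>2"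
proof -
  have "(\<Sum>i\<in>F. (row M i \<bullet> w)\<^sup>2) \<le> (\<Sum>i<dim_row M. (row M i \<bullet> w)\<^sup>2)"
    using assms by (intro sum_mono2) auto
  also have "\<dots> \<le> (spectral_norm M * vnorm w)\<^sup>2"
    unfolding vnorm_mult_mat_vec_sq[symmetric]
    using vnorm_mult_mat_vec_le[OF w] by (intro power_mono) auto
  finally show ?thesis
    by (simp add: power_mult_distrib)
qed

section \<open>Means of sets of rows\<close>

lemma centroid_carrier [simp]: "centroid A W \<in> carrier_vec (dim_col A)"
  by (simp add: centroid_def)

lemma centroid_scalar_prod:
  assumes "W \<subseteq> {..<dim_row A}" and w: "w \<in> carrier_vec (dim_col A)"
  shows "centroid A W \<bullet> w = (\<Sum>i\<in>W. row A i \<bullet> w) / real (card W)"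
proof -
  have "centroid A W \<bullet> w = (\<Sum>j=0..<dim_col A. \<Sum>i\<in>W. A $$ (i, j) * w $ j / real (card W))"
    using w by (simp add: centroid_def scalar_prod_def sum_distrib_right sum_divide_distrib)
  also have "\<dots> = (\<Sum>i\<in>W. (\<Sum>j=0..<dim_col A. A $$ (i, j) * w $ j) / real (card W))"
    by (subst sum.swap) (simp add: sum_divide_distrib)
  also have "\<dots> = (\<Sum>i\<in>W. (row A i \<bullet> w) / real (card W))"
    using assms by (intro sum.cong) (auto simp: scalar_prod_def intro!: sum.cong)
  finally show ?thesis
    by (simp add: sum_divide_distrib)
qed

text \<open>The rows in \<open>W\<close> are tested against their own mean \<open>z\<close>:
  \<open>card W * (vnorm z)\<^sup>2\<close> is the sum of the products
  \<open>row M i \<bullet> z\<close>, and Cauchy-Schwarz over \<open>W\<close> bounds that sum by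
  \<open>sqrt (card W) * spectral_norm M * vnorm z\<close>.\<close>

lemma vnorm_centroid_le:
  assumes W: "W \<subseteq> {..<dim_row M}" "W \<noteq> {}"
  shows "vnorm (centroid M W) \<le> spectral_norm M / sqrt (real (card W))"
proof (cases "vnorm (centroid M W) = 0")
  case True
  then show ?thesis
    using spectral_norm_nonneg[of M] by simp
next
  case False
  let ?z = "centroid M W" and ?N = "real (card W)"
  have pos: "vnorm ?z > 0"
    using False vnorm_nonneg[of ?z] by linarith
  have "finite W"
    using W finite_subset by blast
  then have N: "?N > 0"
    using W by (simp add: card_gt_0_iff)
  have "?N * (vnorm ?z)\<^sup>2 = (\<Sum>i\<in>W. row M i \<bullet> ?z)"
    using N centroid_scalar_prod[OF W(1) centroid_carrier] by (simp add: vnorm_sq)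
  \<comment> \<open>The constant factor 1 prepares Cauchy-Schwarz; its norm over \<open>W\<close> is
    \<open>sqrt ?N\<close>.\<close>
  also have "\<dots> \<le> (\<Sum>i\<in>W. \<bar>row M i \<bullet> ?z\<bar> * \<bar>1\<bar>)"
    by (intro sum_mono) simp
  also have "\<dots> \<le> L2_set (\<lambda>i. row M i \<bullet> ?z) W * L2_set (\<lambda>i. 1) W"
    by (rule L2_set_mult_ineq)
  also have "\<dots> \<le> (spectral_norm M * vnorm ?z) * sqrt ?N"
    using sum_row_scalar_prod_sq_le[OF W(1) centroid_carrier] spectral_norm_nonneg[of M]
    by (intro mult_mono) (auto simp: L2_set_def real_le_lsqrt power_mult_distrib sum_nonneg)
  finally have "(sqrt ?N * vnorm ?z) * (sqrt ?N * vnorm ?z)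
      \<le> spectral_norm M * (sqrt ?N * vnorm ?z)"
    using N by (simp add: power2_eq_square algebra_simps)
  then have "sqrt ?N * vnorm ?z \<le> spectral_norm M"
    using N pos by simp
  then show ?thesis
    using N by (simp add: field_simps)
qed

text \<open>By \<open>nearer_iff\<close> the condition defines a half-space, and a mean of points of
  a half-space stays in it.\<close>

lemma centroid_nearer:
  assumes W: "W \<subseteq> {..<dim_row A}" "W \<noteq> {}"
    and a: "a \<in> carrier_vec (dim_col A)" and b: "b \<in> carrier_vec (dim_col A)"
    and near: "\<And>i. i \<in> W \<Longrightarrow> vnorm (row A i - a) \<le> vnorm (row A i - b)"
  shows "vnorm (centroid A W - a) \<le> vnorm (centroid A W - b)"
proof -
  let ?B = "((vnorm b)\<^sup>2 - (vnorm a)\<^sup>2) / 2"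
  have "finite W"
    using W finite_subset by blast
  then have N: "real (card W) > 0"
    using W by (simp add: card_gt_0_iff)
  have "row A i \<bullet> (b - a) \<le> ?B" if "i \<in> W" for i
    using near[OF that] nearer_iff[of "row A i" "dim_col A" a b] a b by (simp add: row_def)
  then have "(\<Sum>i\<in>W. row A i \<bullet> (b - a)) \<le> real (card W) * ?B"
    by (rule sum_bounded_above)
  then have "(\<Sum>i\<in>W. row A i \<bullet> (b - a)) / real (card W) \<le> ?B"
    using N by (simp only: pos_divide_le_eq mult.commute)
  then have "centroid A W \<bullet> (b - a) \<le> ?B"
    using centroid_scalar_prod[OF W(1), of "b - a"] a b by simp
  then show ?thesis
    using nearer_iff[OF centroid_carrier a b] by simp
qed

text \<open>The rows of \<open>C\<close> are constant on \<open>W\<close>, so averaging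
  \<open>A - C\<close> over \<open>W\<close> subtracts that constant. With
  \<open>vnorm_centroid_le\<close> this bounds the distance from the mean of \<open>W\<close> to the
  mean of its cluster.\<close>

lemma centroid_minus_center:
  assumes C: "center_matrix k A T C" and r: "r < k"
    and W: "W \<subseteq> T r" "W \<subseteq> {..<dim_row A}" "W \<noteq> {}"
  shows "centroid A W - centroid A (T r) = centroid (A - C) W"
proof (rule eq_vecI)
  have Cc: "C \<in> carrier_mat (dim_row A) (dim_col A)"
    using C by (simp add: center_matrix_def)
  have "finite W"
    using W finite_subset by blast
  then have N: "real (card W) > 0"
    using W by (simp add: card_gt_0_iff)
  fix j assume "j < dim_vec (centroid (A - C) W)"
  then have j: "j < dim_col A"
    using Cc by (simp add: centroid_def)
  have "(A - C) $$ (i, j) = A $$ (i, j) - centroid A (T r) $ j" if "i \<in> W" for i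
  proof -
    have i: "i < dim_row A" "row C i = centroid A (T r)"
      using that W C r by (auto simp: center_matrix_def)
    have "C $$ (i, j) = row C i $ j"
      using i(1) j Cc by auto
    then show ?thesis
      using i j Cc by simp
  qed
  then have "(\<Sum>i\<in>W. (A - C) $$ (i, j)) = (\<Sum>i\<in>W. A $$ (i, j) - centroid A (T r) $ j)"
    by (intro sum.cong) auto
  also have "\<dots> = (\<Sum>i\<in>W. A $$ (i, j)) - real (card W) * centroid A (T r) $ j"
    by (simp add: sum_subtractf)
  finally show "(centroid A W - centroid A (T r)) $ j = centroid (A - C) W $ j"
    using j Cc N by (simp add: centroid_def[of A W] centroid_def[of "A - C"] diff_divide_distrib)
      (simp add: centroid_def)
next
  show "dim_vec (centroid A W - centroid A (T r)) = dim_vec (centroid (A - C) W)"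
    using C by (auto simp: center_matrix_def centroid_def)
qed

lemma row_minus_center:
  assumes "center_matrix k A T C" "r < k" "i \<in> T r" "i < dim_row A"
  shows "row (A - C) i = row A i - centroid A (T r)"
proof -
  have "C \<in> carrier_mat (dim_row A) (dim_col A)"
    using assms by (simp add: center_matrix_def)
  then have "row (A - C) i = row A i - row C i"
    using assms(4) by (intro eq_vecI) auto
  then show ?thesis
    using assms by (auto simp: center_matrix_def)
qed

section \<open>Proximal points assigned to a wrong center\<close>

text \<open>With the projection written as \<open>a + t (b - a)\<close>, the proximity gap is
  \<open>(\<bar>t - 1\<bar> - \<bar>t\<bar>) * vnorm (b - a)\<close>. It is at most
  \<open>vnorm (b - a)\<close>, and for \<open>t \<le> 1\<close> at most
  \<open>(1 - 2 * t) * vnorm (b - a)\<close>, where \<open>t\<close> encodes the scalar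
  product.\<close>

lemma line_proj_proximity:
  assumes a: "a \<in> carrier_vec d" and b: "b \<in> carrier_vec d" and x: "x \<in> carrier_vec d"
    and "a \<noteq> b" and D: "D \<ge> 0"
    and prox: "vnorm (line_proj a b x - b) - vnorm (line_proj a b x - a) \<ge> D"
  shows "2 * ((x - a) \<bullet> (b - a)) \<le> (vnorm (b - a))\<^sup>2 - D * vnorm (b - a)"
    and "D \<le> vnorm (b - a)"
proof -
  define L where "L = vnorm (b - a)"
  define t where "t = ((x - a) \<bullet> (b - a)) / ((b - a) \<bullet> (b - a))"
  have "L \<noteq> 0"
    using \<open>a \<noteq> b\<close> vnorm_minus_eq_0_iff[OF b a] by (auto simp: L_def)
  then have L: "L > 0"
    using vnorm_nonneg[of "b - a"] unfolding L_def by linarith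
  have p: "line_proj a b x - a = t \<cdot>\<^sub>v (b - a)" "line_proj a b x - b = (t - 1) \<cdot>\<^sub>v (b - a)"
    unfolding line_proj_def t_def[symmetric]
    using a b by (auto intro!: eq_vecI simp: algebra_simps)
  have ineq: "(\<bar>t - 1\<bar> - \<bar>t\<bar>) * L \<ge> D"
    using prox unfolding p vnorm_smult L_def by (simp add: algebra_simps)
  have "(\<bar>t - 1\<bar> - \<bar>t\<bar>) * L \<le> 1 * L"
    using L by (intro mult_right_mono) auto
  with ineq show DL: "D \<le> vnorm (b - a)"
    by (simp add: L_def)
  have "t \<le> 1"
  proof (rule ccontr)
    assume "\<not> t \<le> 1"
    then have "\<bar>t - 1\<bar> - \<bar>t\<bar> = -1" by simp
    with ineq L D show False by simp
  qed
  \<comment> \<open>Equality holds for \<open>0 \<le> t \<le> 1\<close>; for negative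
    \<open>t\<close> the left factor is 1 and the right one exceeds 1.\<close>
  then have "(\<bar>t - 1\<bar> - \<bar>t\<bar>) * L \<le> (1 - 2 * t) * L"
    using L by (intro mult_right_mono) auto
  with ineq have "D \<le> (1 - 2 * t) * L"
    by linarith
  then have "D * L \<le> (1 - 2 * t) * L * L"
    using L by (intro mult_right_mono) auto
  moreover have "(x - a) \<bullet> (b - a) = t * L\<^sup>2"
    using L by (simp add: t_def L_def vnorm_sq) (simp add: vnorm_def)
  ultimately show "2 * ((x - a) \<bullet> (b - a)) \<le> (vnorm (b - a))\<^sup>2 - D * vnorm (b - a)"
    by (simp add: L_def power2_eq_square algebra_simps)
qed

text \<open>The origin is the mean of \<open>T r\<close>: there \<open>e\<close> is the position of
  \<open>\<nu> r\<close> and \<open>u + f\<close> that of \<open>\<nu> s\<close>. The half-space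
  inequality is expanded, \<open>u \<bullet> f\<close> is bounded by Cauchy-Schwarz and the square
  of \<open>vnorm f\<close> is dropped.\<close>

lemma nearer_shifted:
  assumes y: "y \<in> carrier_vec d" and u: "u \<in> carrier_vec d"
    and e: "e \<in> carrier_vec d" and f: "f \<in> carrier_vec d"
    and near: "vnorm (y - (u + f)) \<le> vnorm (y - e)"
  shows "2 * (y \<bullet> (f - e)) \<ge> (vnorm u)\<^sup>2 - 2 * vnorm u * vnorm f - (vnorm e)\<^sup>2 - 2 * (y \<bullet> u)"
proof -
  have "2 * (y \<bullet> (e - (u + f))) \<le> (vnorm e)\<^sup>2 - (vnorm (u + f))\<^sup>2"
    using near nearer_iff[of y d "u + f" e] y u e f by simp
  moreover have "y \<bullet> (e - (u + f)) = - (y \<bullet> (f - e)) - y \<bullet> u"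
    using y u e f by (simp add: scalar_prod_minus_distrib[of _ d] scalar_prod_add_distrib[of _ d])
  moreover have "(vnorm (u + f))\<^sup>2 \<ge> (vnorm u)\<^sup>2 - 2 * vnorm u * vnorm f"
    using abs_scalar_prod_le[OF u f] vnorm_add_sq[OF u f] zero_le_power2[of "vnorm f"] by linarith
  ultimately show ?thesis by linarith
qed

text \<open>Inserting \<open>prox\<close> into \<open>nearer_shifted\<close> leaves
  \<open>D * vnorm u\<close> minus the error terms \<open>2 * vnorm u * vnorm f\<close> and
  \<open>(vnorm e)\<^sup>2\<close>, which are at most 1/8 and 1/256 of it. Half of 1 - 1/8 - 1/256
  is 223/512, which exceeds 43/100.\<close>

lemma misassigned_scalar_prod_ge:
  assumes y: "y \<in> carrier_vec d" and u: "u \<in> carrier_vec d"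
    and e: "e \<in> carrier_vec d" and f: "f \<in> carrier_vec d"
    and near: "vnorm (y - (u + f)) \<le> vnorm (y - e)"
    and prox: "2 * (y \<bullet> u) \<le> (vnorm u)\<^sup>2 - D * vnorm u" and DL: "D \<le> vnorm u"
    and small: "vnorm e + vnorm f \<le> D / 16"
  shows "y \<bullet> (f - e) \<ge> 43 / 100 * (D * vnorm u)"
proof -
  have D: "0 \<le> D" and e16: "vnorm e \<le> D / 16" and f16: "vnorm f \<le> D / 16"
    using small vnorm_nonneg[of e] vnorm_nonneg[of f] by linarith+
  have "vnorm u * vnorm f \<le> vnorm u * (D / 16)"
    using f16 by (intro mult_left_mono) auto
  moreover have "(vnorm e)\<^sup>2 \<le> (D / 16) * (vnorm u / 16)"
    unfolding power2_eq_square using e16 DL D by (intro mult_mono) auto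
  moreover have "0 \<le> D * vnorm u"
    using D by simp
  ultimately show ?thesis
    using nearer_shifted[OF y u e f near] prox by (simp add: algebra_simps)
qed

text \<open>A Chebyshev-type count: each row in \<open>F\<close> contributes at least
  \<open>B\<^sup>2\<close> to a sum of squares controlled by the spectral norm.\<close>

lemma card_le_of_scalar_prod_ge:
  assumes F: "F \<subseteq> {..<dim_row M}" and w: "w \<in> carrier_vec (dim_col M)" and "0 \<le> B"
    and ge: "\<And>i. i \<in> F \<Longrightarrow> row M i \<bullet> w \<ge> B"
  shows "real (card F) * B\<^sup>2 \<le> (spectral_norm M)\<^sup>2 * (vnorm w)\<^sup>2"
proof -
  have "real (card F) * B\<^sup>2 = (\<Sum>i\<in>F. B\<^sup>2)"
    by simp
  also have "\<dots> \<le> (\<Sum>i\<in>F. (row M i \<bullet> w)\<^sup>2)"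
    using ge \<open>0 \<le> B\<close> by (intro sum_mono power_mono)
  also have "\<dots> \<le> (spectral_norm M)\<^sup>2 * (vnorm w)\<^sup>2"
    by (rule sum_row_scalar_prod_sq_le[OF F w])
  finally show ?thesis .
qed

lemma row_scalar_prod_eq_0:
  assumes "spectral_norm M = 0" "i < dim_row M" "w \<in> carrier_vec (dim_col M)"
  shows "row M i \<bullet> w = 0"
  using sum_row_scalar_prod_sq_le[of "{i}" M w] assms by simp

text \<open>
  If \<open>\<parallel>A - C\<parallel> = 0\<close>, the right-hand side is the junk value \<open>x / 0 = 0\<close>, so there must be no
  misassigned point at all.
\<close>

lemma card_misassigned_le:
  fixes A :: "real mat" and d k :: nat
  assumes c: "c \<ge> 2" and A: "A \<in> carrier_mat n d" and T: "clustering n k T"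
    and C: "center_matrix k A T C"
    and r: "r < k" and s: "s < k" and rs: "r \<noteq> s"
    and neq: "centroid A (T r) \<noteq> centroid A (T s)"
    and \<nu>: "\<nu> r \<in> carrier_vec d" "\<nu> s \<in> carrier_vec d"
    and small: "vnorm (centroid A (T r) - \<nu> r) + vnorm (centroid A (T s) - \<nu> s)
      \<le> Delta c k A C T r s / 16"
  shows "real (card (T r \<inter> nearest_set k A \<nu> s \<inter> proximity_set c k A C T))
    \<le> 6 * c * real k * (spectral_norm (A - C))\<^sup>2
        * ((vnorm (centroid A (T r) - \<nu> r))\<^sup>2 + (vnorm (centroid A (T s) - \<nu> s))\<^sup>2)
        / ((Delta c k A C T r s)\<^sup>2 * (vnorm (centroid A (T r) - centroid A (T s)))\<^sup>2)"
proof -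
  define \<mu> where "\<mu> = (\<lambda>r. centroid A (T r))"
  define M where "M = A - C"
  define D where "D = Delta c k A C T r s"
  define u where "u = \<mu> s - \<mu> r"
  define e where "e = \<nu> r - \<mu> r"
  define f where "f = \<nu> s - \<mu> s"
  define N where "N = spectral_norm M"
  define F where "F = T r \<inter> nearest_set k A \<nu> s \<inter> proximity_set c k A C T"
  have \<mu>: "\<mu> t \<in> carrier_vec d" for t
    using A centroid_carrier[of A "T t"] by (simp add: \<mu>_def)
  have M: "M \<in> carrier_mat n d"
    using C A by (auto simp: M_def center_matrix_def)
  have u: "u \<in> carrier_vec d" and e: "e \<in> carrier_vec d" and f: "f \<in> carrier_vec d"
    using \<mu> \<nu> by (auto simp: u_def e_def f_def)
  have norms: "vnorm (\<mu> r - \<nu> r) = vnorm e" "vnorm (\<mu> s - \<nu> s) = vnorm f"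
    "vnorm (\<mu> r - \<mu> s) = vnorm u"
    using \<mu> \<nu> vnorm_minus_commute unfolding u_def e_def f_def by blast+
  have sub: "T t \<subseteq> {..<n}" "T t \<noteq> {}" if "t < k" for t
    using T that by (auto simp: clustering_def)
  have card_T: "real (card (T t)) > 0" if "t < k" for t
    using sub[OF that] finite_subset[of "T t" "{..<n}"] by (simp add: card_gt_0_iff)
  have k: "real k \<ge> 1"
    using r by simp
  have N0: "N \<ge> 0"
    by (simp add: N_def spectral_norm_nonneg)
  \<comment> \<open>Clusters are nonempty, so no denominator is 0 and \<open>D\<close> vanishes
    exactly when \<open>N\<close> does.\<close>
  have fac: "c * real k / sqrt (real (card (T r))) + c * real k / sqrt (real (card (T s))) > 0"
    using c k card_T[OF r] card_T[OF s] by (intro add_pos_pos divide_pos_pos mult_pos_pos) auto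
  have D_eq: "D = (c * real k / sqrt (real (card (T r))) + c * real k / sqrt (real (card (T s)))) * N"
    by (simp add: D_def Delta_def N_def M_def)
  have D0: "D \<ge> 0"
    using fac N0 by (simp add: D_eq)
  have small': "vnorm e + vnorm f \<le> D / 16"
    using small norms by (simp add: \<mu>_def D_def)
  have "vnorm u \<noteq> 0"
    using neq vnorm_minus_eq_0_iff[OF \<mu>[of s] \<mu>[of r]] by (auto simp: u_def \<mu>_def)
  then have L: "vnorm u > 0"
    using vnorm_nonneg[of u] by linarith
  have F: "F \<subseteq> {..<dim_row M}"
    using sub[OF r] M by (auto simp: F_def)
  have row: "row M i \<in> carrier_vec d" "row M i = row A i - \<mu> r"
      "vnorm (row M i - (u + f)) \<le> vnorm (row M i - e)" if i: "i \<in> F" for i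
  proof -
    have in': "i < n" "i \<in> T r" "vnorm (row A i - \<nu> s) \<le> vnorm (row A i - \<nu> r)"
      using i sub[OF r] r by (auto simp: F_def nearest_set_def)
    show "row M i \<in> carrier_vec d"
      using M in' by auto
    show Mi: "row M i = row A i - \<mu> r"
      using row_minus_center[OF C r in'(2)] in'(1) A by (simp add: M_def \<mu>_def)
    \<comment> \<open>Passing to coordinates centered at \<open>\<mu> r\<close> leaves both
      distances unchanged.\<close>
    have "row M i - (u + f) = row A i - \<nu> s" "row M i - e = row A i - \<nu> r"
      using \<mu>[of r] \<mu>[of s] \<nu> A in'(1) unfolding Mi u_def f_def e_def
      by (auto intro!: eq_vecI)
    then show "vnorm (row M i - (u + f)) \<le> vnorm (row M i - e)"
      using in' by simp
  qed
  show ?thesis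
  proof (cases "N = 0")
    case True
    then have D_0: "D = 0"
      by (simp add: D_eq)
    then have ef: "vnorm e = 0" "vnorm f = 0"
      using small' vnorm_nonneg[of e] vnorm_nonneg[of f] by linarith+
    have "F = {}"
    proof (rule ccontr)
      assume "F \<noteq> {}"
      then obtain i where i: "i \<in> F" by blast
      have "row M i \<bullet> z = 0" if "z \<in> carrier_vec d" for z
        using row_scalar_prod_eq_0[of M i z] True i F M that by (auto simp: N_def)
      \<comment> \<open>Every other term of \<open>nearer_shifted\<close> is 0 here: both centers
        coincide with their means and all products with the row vanish.\<close>
      then have "(vnorm u)\<^sup>2 \<le> 0"
        using nearer_shifted[OF row(1)[OF i] u e f row(3)[OF i]] ef u e f by simp
      with L show False by simp
    qed
    then show ?thesis
      using D_0 unfolding F_def D_def by simp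
  next
    case False
    then have Dp: "D > 0"
      using fac N0 by (simp add: D_eq)
    have ge: "row M i \<bullet> (f - e) \<ge> 43 / 100 * (D * vnorm u)" if i: "i \<in> F" for i
    proof -
      have "i \<in> T r" and "i \<in> proximity_set c k A C T"
        using i by (auto simp: F_def)
      then obtain q where q: "q < k" "i \<in> T q"
        and prox: "\<And>t. t < k \<Longrightarrow> t \<noteq> q \<Longrightarrow>
          vnorm (line_proj (\<mu> q) (\<mu> t) (row A i) - \<mu> t)
            - vnorm (line_proj (\<mu> q) (\<mu> t) (row A i) - \<mu> q) \<ge> Delta c k A C T q t"
        by (auto simp: proximity_set_def Let_def \<mu>_def)
      \<comment> \<open>\<open>proximity_set\<close> only provides some cluster containing
        \<open>i\<close>; disjointness identifies it with \<open>T r\<close>.\<close>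
      have "q = r"
        using T q \<open>i \<in> T r\<close> r unfolding clustering_def disjoint_family_on_def by blast
      have "i < n"
        using F i M by auto
      then have Ai: "row A i \<in> carrier_vec d"
        using A by auto
      have "D \<le> vnorm (line_proj (\<mu> r) (\<mu> s) (row A i) - \<mu> s)
            - vnorm (line_proj (\<mu> r) (\<mu> s) (row A i) - \<mu> r)"
        using prox[of s] s rs \<open>q = r\<close> by (simp add: D_def)
      from line_proj_proximity[OF \<mu> \<mu> Ai _ D0 this] neq
      have "2 * (row M i \<bullet> u) \<le> (vnorm u)\<^sup>2 - D * vnorm u" "D \<le> vnorm u"
        unfolding row(2)[OF i] u_def by (simp_all add: \<mu>_def)
      then show ?thesis
        using misassigned_scalar_prod_ge[OF row(1)[OF i] u e f row(3)[OF i] _ _ small'] by simp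
    qed
    have fe: "f - e \<in> carrier_vec (dim_col M)"
      using f e M by simp
    define E where "E = (vnorm e)\<^sup>2 + (vnorm f)\<^sup>2"
    have "vnorm (f - e) \<le> vnorm f + vnorm e"
      using vnorm_triangle[OF f e, of "0\<^sub>v d"] vnorm_minus_commute[OF e, of "0\<^sub>v d"] e f
      by simp
    then have "(vnorm (f - e))\<^sup>2 \<le> (vnorm f + vnorm e)\<^sup>2"
      by (intro power_mono) auto
    also have "\<dots> \<le> 2 * E"
      using sum_squares_bound[of "vnorm f" "vnorm e"] by (simp add: E_def power2_sum)
    finally have fe_sq: "(vnorm (f - e))\<^sup>2 \<le> 2 * E" .
    have E0: "E \<ge> 0"
      by (simp add: E_def)
    have "real (card F) * (43 / 100 * (D * vnorm u))\<^sup>2 \<le> N\<^sup>2 * (vnorm (f - e))\<^sup>2"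
      unfolding N_def using D0 by (intro card_le_of_scalar_prod_ge[OF F fe _ ge]) auto
    also have "\<dots> \<le> N\<^sup>2 * (2 * E)"
      using fe_sq by (intro mult_left_mono) auto
    finally have "real (card F) * (D\<^sup>2 * (vnorm u)\<^sup>2) * (1849 / 10000) \<le> 2 * (N\<^sup>2 * E)"
      by (simp add: power_mult_distrib power_divide algebra_simps)
    \<comment> \<open>2 / 0.1849 is below 12, and 12 is at most \<open>6 * c * real k\<close>
      because \<open>c \<ge> 2\<close> and \<open>k \<ge> 1\<close>.\<close>
    then have "real (card F) * (D\<^sup>2 * (vnorm u)\<^sup>2) \<le> 12 * (N\<^sup>2 * E)"
      using E0 mult_nonneg_nonneg[OF zero_le_power2[of N] E0] by linarith
    also have "\<dots> \<le> (6 * c * real k) * (N\<^sup>2 * E)"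
      using c k E0 mult_mono[of 2 c 1 "real k"] by (intro mult_right_mono) auto
    finally have "real (card F) \<le> 6 * c * real k * N\<^sup>2 * E / (D\<^sup>2 * (vnorm u)\<^sup>2)"
      using Dp L by (simp add: field_simps)
    then show ?thesis
      using norms by (simp add: F_def E_def N_def M_def D_def \<mu>_def)
  qed
qed

section \<open>Means of misassigned points\<close>

text \<open>Going from \<open>m\<close> to \<open>b\<close> through \<open>b'\<close> and
  \<open>a'\<close> costs at most \<open>vnorm (m - a)\<close> plus 1/16 of
  \<open>vnorm (a - b)\<close>. The triangle inequality for \<open>a\<close>, \<open>m\<close>,
  \<open>b\<close> then bounds \<open>vnorm (a - b)\<close> by 32/15 of
  \<open>vnorm (m - a)\<close>, so even 17/15 would do in place of 4.\<close>

lemma dist_le_of_nearer: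
  assumes car: "m \<in> carrier_vec d" "a \<in> carrier_vec d" "b \<in> carrier_vec d"
      "a' \<in> carrier_vec d" "b' \<in> carrier_vec d"
    and near: "vnorm (m - b') \<le> vnorm (m - a')"
    and small: "vnorm (a - a') + vnorm (b - b') \<le> vnorm (a - b) / 16"
  shows "vnorm (m - b) \<le> 4 * vnorm (m - a)"
proof -
  have "vnorm (a - b) \<le> vnorm (a - m) + vnorm (m - b)"
    "vnorm (m - b) \<le> vnorm (m - b') + vnorm (b' - b)"
    "vnorm (m - a') \<le> vnorm (m - a) + vnorm (a - a')"
    using car vnorm_triangle by blast+
  moreover have "vnorm (a - m) = vnorm (m - a)" "vnorm (b' - b) = vnorm (b - b')"
    using car vnorm_minus_commute by blast+
  ultimately show ?thesis
    using near small vnorm_nonneg[of "m - a"] by linarith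
qed

text \<open>Distinct means make every line in the proximity condition well defined. Part (2) carries
  the separation of \<open>\<mu> r\<close> and \<open>\<mu> s\<close> by at least
  \<open>\<Delta> r s\<close> as an explicit premise; by \<open>line_proj_proximity\<close>, a
  single proximal point in \<open>T r\<close> would already force it.\<close>

theorem theorem2:
  "\<exists>c0::real. c0 > 0 \<and> (\<forall>c\<ge>c0. \<forall>n d k :: nat.
     \<forall>(A :: real mat) (C :: real mat) (T :: nat \<Rightarrow> nat set) (\<nu> :: nat \<Rightarrow> real vec).
       let \<mu> = (\<lambda>r. centroid A (T r));
           \<delta> = (\<lambda>r. vnorm (\<mu> r - \<nu> r));
           \<Delta> = Delta c k A C T;
           S = nearest_set k A \<nu>;
           G = proximity_set c k A C T
       in
         A \<in> carrier_mat n d \<longrightarrow>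
         clustering n k T \<longrightarrow>
         center_matrix k A T C \<longrightarrow>
         (\<forall>r<k. \<forall>s<k. r \<noteq> s \<longrightarrow> \<mu> r \<noteq> \<mu> s) \<longrightarrow>
         (\<forall>r<k. \<nu> r \<in> carrier_vec d) \<longrightarrow>
         (\<forall>r<k. \<forall>s<k. vnorm (\<mu> r - \<nu> r) \<le> vnorm (\<mu> r - \<nu> s)) \<longrightarrow>
         (\<forall>r<k. \<forall>s<k. r \<noteq> s \<longrightarrow> \<delta> r + \<delta> s \<le> \<Delta> r s / 16) \<longrightarrow>
         (\<forall>r<k. \<forall>s<k. r \<noteq> s \<longrightarrow>
            real (card (T r \<inter> S s \<inter> G))
              \<le> 6 * c * real k * (spectral_norm (A - C))\<^sup>2 * ((\<delta> r)\<^sup>2 + (\<delta> s)\<^sup>2)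
                  / ((\<Delta> r s)\<^sup>2 * (vnorm (\<mu> r - \<mu> s))\<^sup>2) \<and>
            (vnorm (\<mu> r - \<mu> s) \<ge> \<Delta> r s \<longrightarrow>
              (\<forall>W. W \<noteq> {} \<and> W \<subseteq> T r \<inter> S s \<longrightarrow>
                 vnorm (centroid A W - \<mu> s) \<le> 100 * spectral_norm (A - C) / sqrt (real (card W))))))"
  unfolding Let_def
\<comment> \<open>The witness 2 is what turns the constant 12 of the counting argument into
  \<open>6 * c * real k\<close>.\<close>
proof (intro exI[of _ 2] conjI allI impI, goal_cases)
  case 1
  show ?case by simp
next
  case (2 c n d k A C T \<nu> r s)
  then show ?case
    by (intro card_misassigned_le[of c A n d k T C r s \<nu>]) blast+
next
  case (3 c n d k A C T \<nu> r s W)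
  then have r: "r < k" and s: "s < k" and A: "A \<in> carrier_mat n d"
    and T: "clustering n k T" and C: "center_matrix k A T C"
    and \<nu>: "\<nu> r \<in> carrier_vec d" "\<nu> s \<in> carrier_vec d"
    and W: "W \<noteq> {}" "W \<subseteq> T r" "W \<subseteq> nearest_set k A \<nu> s"
    and "vnorm (centroid A (T r) - \<nu> r) + vnorm (centroid A (T s) - \<nu> s)
      \<le> Delta c k A C T r s / 16"
    and "Delta c k A C T r s \<le> vnorm (centroid A (T r) - centroid A (T s))"
    by blast+
  \<comment> \<open>The separation premise replaces \<open>Delta\<close> by the distance of the
    means, the form needed for \<open>dist_le_of_nearer\<close>.\<close>
  then have small: "vnorm (centroid A (T r) - \<nu> r) + vnorm (centroid A (T s) - \<nu> s)
      \<le> vnorm (centroid A (T r) - centroid A (T s)) / 16"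
    by linarith
  have dim: "dim_col A = d" "dim_row A = n" "dim_row (A - C) = n"
    using A C by (auto simp: center_matrix_def)
  have Wn: "W \<subseteq> {..<n}"
    using T r W by (auto simp: clustering_def)
  have car: "centroid A V \<in> carrier_vec d" for V
    using centroid_carrier[of A V] dim by simp
  have "vnorm (centroid A W - \<nu> s) \<le> vnorm (centroid A W - \<nu> r)"
    using Wn W \<nu> dim r by (intro centroid_nearer) (auto simp: nearest_set_def)
  then have "vnorm (centroid A W - centroid A (T s)) \<le> 4 * vnorm (centroid A W - centroid A (T r))"
    using dist_le_of_nearer[OF car car car \<nu> _ small] by blast
  also have "\<dots> = 4 * vnorm (centroid (A - C) W)"
    using centroid_minus_center[OF C r W(2)] Wn W dim by simp
  also have "\<dots> \<le> 4 * (spectral_norm (A - C) / sqrt (real (card W)))"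
    using vnorm_centroid_le[of W "A - C"] Wn W dim by simp
  \<comment> \<open>The argument gives the constant 4; 100 leaves ample room.\<close>
  also have "\<dots> \<le> 100 * (spectral_norm (A - C) / sqrt (real (card W)))"
    using spectral_norm_nonneg[of "A - C"] by (intro mult_right_mono) auto
  finally show ?case by simp
qed

end
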